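(* Let $\lambda=(\lambda_1,\dots,\lambda_n)\in\mathbb{C}^n$ have pairwise distinct components, let $A=\mathrm{diag}(\lambda_1,\dots,\lambda_n)\in GL(n,\mathbb{C})$ be non-resonant, and let $\mathbf{f}\in V_1$. Then the equation $$\mathbf{h}=D_\lambda^{-1}\left(\mathbf{f}\circ(\mathbf{z}+\mathbf{h})\right)$$ admits a unique solution $\mathbf{h}\in V_1$, $\mathbf{h}=\sum_{\alpha\in\mathbb{N}^n}\mathbf{h}_\alpha z^\alpha$. For $|\alpha|\ge2$ the $j$-th component of the coefficient $\mathbf{h}_\alpha$ is given by $$h_{\alpha,j}=\sum_{N=1}^{|\alpha|-1}\ \sum_{\vartheta\in\mathcal{T}_{N,\alpha,j}}\left((\Omega^{-1}_{\nu_{\ell_{v_1}}}\mathbf{f}_{\alpha_{v_1}})\cdot\beta^{\ell_{v_1}}\right)\prod_{v\in\vartheta}\binom{\alpha_v}{\beta_v}\prod_{\ell_w\in L_v}\left((\Omega^{-1}_{\nu_{\ell_w}}\mathbf{f}_{\alpha_w})\cdot\beta^{\ell_w}\right),$$ where $v_1$ is the root of $\vartheta$ and the last product is set equal to $1$ whenever $v$ is an end node ($L_v=\emptyset$).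
   Context: For $\alpha\in\mathbb{Z}^n$, $|\alpha|=\alpha_1+\dots+\alpha_n$; for $\alpha\in\mathbb{N}^n$, $z^\alpha=z_1^{\alpha_1}\cdots z_n^{\alpha_n}$, $\alpha!=\alpha_1!\cdots\alpha_n!$, and $\binom{\alpha}{\beta}=\frac{\alpha!}{\beta!(\alpha-\beta)!}$ if $\beta_i\le\alpha_i$ for all $i$, and $0$ otherwise. $e_j$ is the $j$-th canonical basis vector. $V=\mathbb{C}^n[[z_1,\dots,z_n]]$ is the space of formal power series $\mathbf{f}=\sum_{\alpha\in\mathbb{N}^n}\mathbf{f}_\alpha z^\alpha$, $\mathbf{f}_\alpha=(f_{\alpha,1},\dots,f_{\alpha,n})\in\mathbb{C}^n$; $v(\mathbf{f})=\inf\{|\alpha|:\mathbf{f}_\alpha\ne0\}$, $V_j=\{\mathbf{f}\in V:v(\mathbf{f})>j\}$, and $\mathbf{z}$ denotes the identity series. $A$ is non-resonant if $\lambda^\alpha\ne\lambda_j$ for all $\alpha\in\mathbb{N}^n$ with $|\alpha|\ge2$ and all $j\in\{1,\dots,n\}$, where $\lambda^\alpha=\lambda_1^{\alpha_1}\cdots\lambda_n^{\alpha_n}$. $D_\lambda\mathbf{g}(\mathbf{z})=\mathbf{g}(A\mathbf{z})-A\mathbf{g}(\mathbf{z})$, which is invertible on $V_1$ when $A$ is non-resonant. $\Omega_\alpha=\mathrm{diag}(\lambda^\alpha-\lambda_1,\dots,\lambda^\alpha-\lambda_n)$; thus $(\Omega_\nu^{-1}\mathbf{f}_\alpha)\cdot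 e_i=f_{\alpha,i}/(\lambda^\nu-\lambda_i)$. Trees: $\mathcal{T}_N$ is the set of rooted trees with $N$ nodes in which the subtrees attached to each node are ordered (equivalently $\mathcal{T}_1$ consists of the single-node tree, and $\vartheta\in\mathcal{T}_N$, $N\geq 2$, is $(t,\vartheta^1,\dots,\vartheta^t)$ with $t\ge1$, $\vartheta^i\in\mathcal{T}_{N_i}$, $\sum N_i=N-1$). Each node $v$ has an exiting line $\ell_v$ (for the root $v_1$, the root line); $L_v$ is the set of lines entering $v$ (the exiting lines of its children); an end node is a node with no entering lines. Nodes are partially ordered with the root maximal: $w\le v$ iff $v$ lies on the path from the root to $w$. Labels: each node $v$ carries a label $\alpha_v\in\mathbb{N}^n$ with $|\alpha_v|\ge2$ and each line $\ell_v$ carries a label $\beta^{\ell_v}\in\mathbb{N}^n$ with $|\beta^{\ell_v}|=1$. Put $\beta_v=\sum_{\ell\in L_v}\beta^\ell$; the momentum of $\ell_v$ is $\nu_{\ell_v}=\sum_{w\le v}(\alpha_w-\beta_w)$, and the total momentum is $\nu_\vartheta=\nu_{\ell_{v_1}}$. $\mathcal{T}_{N,\alpha,j}$ is the set of labeled rooted trees of order $N$ with $\nu_\vartheta=\alpha$ and $\beta^{\ell_{v_1}}=e_j$. Summands in which some binomial $\binom{\alpha_v}{\beta_v}$ vanishes are taken to be $0$.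
   Formalization: The sum over all ordered labeled trees overcounts for n≥2 (e.g. λ=(2,3), f=(z1z2,z1z2), α=(2,2)); it is restricted to trees in which, at each node, the subtrees are ordered so that entering lines labeled e_i precede those labeled e_j for i<j. *)

theory Defs
  imports "HOL-Analysis.Analysis" "HOL-Library.Groups_Big_Fun"
begin

section \<open>Multi-indices\<close>

definition msize :: "'a::comm_monoid_add ^ 'n \<Rightarrow> 'a" where
  "msize \<alpha> = (\<Sum>i\<in>UNIV. \<alpha> $ i)"

definition mfact :: "nat ^ 'n \<Rightarrow> complex" where
  "mfact \<alpha> = (\<Prod>i\<in>UNIV. fact (\<alpha> $ i))"

definition mbinom :: "nat ^ 'n \<Rightarrow> nat ^ 'n \<Rightarrow> complex" where
  "mbinom \<alpha> \<beta> = (if \<forall>i. \<beta> $ i \<le> \<alpha> $ i then mfact \<alpha> / (mfact \<beta> * mfact (\<alpha> - \<beta>)) else 0)"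

definition int_vec :: "nat ^ 'n \<Rightarrow> int ^ 'n" where
  "int_vec \<alpha> = (\<chi> i. int (\<alpha> $ i))"

lemma finite_mindex_splits: "finite {(\<alpha>, \<beta>). \<alpha> + \<beta> = (\<gamma> :: nat ^ 'n)}"
proof -
  let ?B = "(\<lambda>g. \<chi> i. g i) ` (PiE UNIV (\<lambda>i. {.. \<gamma> $ i})) :: (nat ^ 'n) set"
  have fin: "finite ?B"
    by (intro finite_imageI finite_PiE) auto
  have mem: "\<alpha> \<in> ?B" if "\<forall>i. \<alpha> $ i \<le> \<gamma> $ i" for \<alpha>
    using that by (intro image_eqI[of _ _ "\<lambda>i. \<alpha> $ i"]) (auto simp: vec_eq_iff)
  have le: "\<forall>i. \<alpha> $ i \<le> \<gamma> $ i" "\<forall>i. \<beta> $ i \<le> \<gamma> $ i" if "\<alpha> + \<beta> = \<gamma>" for \<alpha> \<beta>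
    by (simp_all flip: that)
  have "{(\<alpha>, \<beta>). \<alpha> + \<beta> = \<gamma>} \<subseteq> ?B \<times> ?B"
    using mem[OF le(1)] mem[OF le(2)] by blast
  then show ?thesis
    using fin by (meson finite_SigmaI finite_subset)
qed

section \<open>Formal power series in the variables \<open>z\<^sub>i\<close>, \<open>i :: 'n\<close>\<close>

typedef 'n mfps = "UNIV :: (nat ^ 'n::finite \<Rightarrow> complex) set"
  morphisms mcoeff Abs_mfps ..

setup_lifting type_definition_mfps

lemma mfps_eqI: "(\<And>\<alpha>. mcoeff a \<alpha> = mcoeff b \<alpha>) \<Longrightarrow> a = b"
  by (metis ext mcoeff_inject)

instantiation mfps :: (finite) comm_ring_1
begin

lift_definition zero_mfps :: "'a mfps" is "\<lambda>\<alpha>. 0" .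
lift_definition one_mfps :: "'a mfps" is "\<lambda>\<alpha>. if \<alpha> = 0 then 1 else 0" .
lift_definition plus_mfps :: "'a mfps \<Rightarrow> 'a mfps \<Rightarrow> 'a mfps" is "\<lambda>a b \<alpha>. a \<alpha> + b \<alpha>" .
lift_definition minus_mfps :: "'a mfps \<Rightarrow> 'a mfps \<Rightarrow> 'a mfps" is "\<lambda>a b \<alpha>. a \<alpha> - b \<alpha>" .
lift_definition uminus_mfps :: "'a mfps \<Rightarrow> 'a mfps" is "\<lambda>a \<alpha>. - a \<alpha>" .
lift_definition times_mfps :: "'a mfps \<Rightarrow> 'a mfps \<Rightarrow> 'a mfps"
  is "\<lambda>a b \<gamma>. \<Sum>(\<alpha>, \<beta>) | \<alpha> + \<beta> = \<gamma>. a \<alpha> * b \<beta>" .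

instance
proof
  fix a b c :: "'a mfps"
  show "a * b * c = a * (b * c)"
  proof (rule mfps_eqI)
    fix \<gamma> :: "nat ^ 'a"
    have "mcoeff (a * b * c) \<gamma> =
        (\<Sum>(\<delta>, \<epsilon>) | \<delta> + \<epsilon> = \<gamma>. \<Sum>(\<alpha>, \<beta>) | \<alpha> + \<beta> = \<delta>. mcoeff a \<alpha> * mcoeff b \<beta> * mcoeff c \<epsilon>)"
      by (simp add: times_mfps.rep_eq sum_distrib_right case_prod_unfold)
    also have "\<dots> = (\<Sum>(\<alpha>, \<delta>) | \<alpha> + \<delta> = \<gamma>. \<Sum>(\<beta>, \<epsilon>) | \<beta> + \<epsilon> = \<delta>. mcoeff a \<alpha> * mcoeff b \<beta> * mcoeff c \<epsilon>)"
      unfolding case_prod_unfold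
      apply (subst sum.Sigma)
        apply (simp_all add: finite_mindex_splits[unfolded case_prod_unfold])
      apply (subst sum.Sigma)
        apply (simp_all add: finite_mindex_splits[unfolded case_prod_unfold])
      by (rule sum.reindex_bij_witness[where
            i = "\<lambda>((\<alpha>, \<delta>), (\<beta>, \<epsilon>)). ((\<alpha> + \<beta>, \<epsilon>), (\<alpha>, \<beta>))" and
            j = "\<lambda>((\<delta>, \<epsilon>), (\<alpha>, \<beta>)). ((\<alpha>, \<beta> + \<epsilon>), (\<beta>, \<epsilon>))"])
         (auto simp: add.assoc)
    also have "\<dots> = mcoeff (a * (b * c)) \<gamma>"
      by (simp add: times_mfps.rep_eq sum_distrib_left case_prod_unfold mult.assoc)
    finally show "mcoeff (a * b * c) \<gamma> = mcoeff (a * (b * c)) \<gamma>" .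
  qed
  show "a * b = b * a"
    by (rule mfps_eqI, unfold times_mfps.rep_eq)
       (rule sum.reindex_bij_witness[where i = prod.swap and j = prod.swap];
         auto simp: add.commute mult.commute)
  show "1 * a = a"
  proof (rule mfps_eqI)
    fix \<gamma> :: "nat ^ 'a"
    have "mcoeff (1 * a) \<gamma> = (\<Sum>(\<alpha>, \<beta>) \<in> {(0 :: nat ^ 'a, \<gamma>)}. (if \<alpha> = 0 then 1 else 0) * mcoeff a \<beta>)"
      unfolding times_mfps.rep_eq one_mfps.rep_eq
    proof (rule sum.mono_neutral_right[OF finite_mindex_splits])
      show "{(0, \<gamma>)} \<subseteq> {(\<alpha>, \<beta>). \<alpha> + \<beta> = \<gamma>}" by simp
    qed (auto split: if_splits)
    then show "mcoeff (1 * a) \<gamma> = mcoeff a \<gamma>" by simp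
  qed
  show "(a + b) * c = a * c + b * c"
    by (rule mfps_eqI)
       (simp add: times_mfps.rep_eq plus_mfps.rep_eq case_prod_unfold distrib_right sum.distrib)
  show "(0 :: 'a mfps) \<noteq> 1"
    by (metis one_mfps.rep_eq zero_mfps.rep_eq zero_neq_one)
qed (rule mfps_eqI;
     simp add: plus_mfps.rep_eq zero_mfps.rep_eq minus_mfps.rep_eq uminus_mfps.rep_eq
       add.assoc add.commute)+

end

lift_definition mfps_const :: "complex \<Rightarrow> 'n::finite mfps" is "\<lambda>c \<alpha>. if \<alpha> = 0 then c else 0" .

lift_definition mfps_var :: "'n::finite \<Rightarrow> 'n mfps" is "\<lambda>i \<alpha>. if \<alpha> = axis i 1 then 1 else 0" .

section \<open>The space \<open>V\<close>\<close>

text \<open>An element of \<open>V\<close> is stored as the vector of its components; \<open>vcoeff \<^bold>f \<alpha>\<close> is its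
  coefficient \<open>\<^bold>f\<^sub>\<alpha> \<in> \<complex>\<^sup>n\<close>.\<close>

type_synonym 'n vfps = "'n mfps ^ 'n"

definition vcoeff :: "'n::finite vfps \<Rightarrow> nat ^ 'n \<Rightarrow> complex ^ 'n" where
  "vcoeff f \<alpha> = (\<chi> i. mcoeff (f $ i) \<alpha>)"

definition vord :: "'n::finite vfps \<Rightarrow> enat" where
  "vord f = (INF \<alpha> \<in> {\<alpha>. vcoeff f \<alpha> \<noteq> 0}. enat (msize \<alpha>))"

definition Vsp :: "nat \<Rightarrow> 'n::finite vfps set" where
  "Vsp j = {f. vord f > enat j}"

definition zid :: "'n::finite vfps" where
  "zid = (\<chi> i. mfps_var i)"

definition matact :: "complex ^ 'n ^ 'n \<Rightarrow> 'n::finite vfps \<Rightarrow> 'n vfps" where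
  "matact A g = (\<chi> i. \<Sum>j\<in>UNIV. mfps_const (A $ i $ j) * g $ j)"

definition mpow :: "'n::finite vfps \<Rightarrow> nat ^ 'n \<Rightarrow> 'n mfps" where
  "mpow g \<alpha> = (\<Prod>i\<in>UNIV. (g $ i) ^ (\<alpha> $ i))"

text \<open>Composition \<open>\<Sum>\<^sub>\<alpha> \<^bold>f\<^sub>\<alpha> \<^bold>g\<^sup>\<alpha>\<close>. If \<open>\<^bold>g\<close> has zero constant term, then each coefficient of the
  result involves only finitely many nonzero terms, as \<open>Sum_any\<close> requires.\<close>

definition vcomp :: "'n::finite vfps \<Rightarrow> 'n vfps \<Rightarrow> 'n vfps" (infixl \<open>\<circ>\<^sub>V\<close> 70) where
  "f \<circ>\<^sub>V g = (\<chi> i. Abs_mfps (\<lambda>\<gamma>. Sum_any (\<lambda>\<alpha>. mcoeff (f $ i) \<alpha> * mcoeff (mpow g \<alpha>) \<gamma>)))"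

section \<open>The linear operator\<close>

definition diag :: "complex ^ 'n \<Rightarrow> complex ^ 'n ^ 'n" where
  "diag lam = (\<chi> i j. if i = j then lam $ i else 0)"

definition lampow :: "complex ^ 'n \<Rightarrow> int ^ 'n \<Rightarrow> complex" where
  "lampow lam \<nu> = (\<Prod>i\<in>UNIV. lam $ i powi (\<nu> $ i))"

definition nonresonant :: "complex ^ 'n \<Rightarrow> bool" where
  "nonresonant lam \<longleftrightarrow>
     (\<forall>\<alpha> :: nat ^ 'n. msize \<alpha> \<ge> 2 \<longrightarrow> (\<forall>j. lampow lam (int_vec \<alpha>) \<noteq> lam $ j))"

definition Dop :: "complex ^ 'n \<Rightarrow> 'n::finite vfps \<Rightarrow> 'n vfps" where
  "Dop lam g = g \<circ>\<^sub>V matact (diag lam) zid - matact (diag lam) g"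

text \<open>In the non-resonant case \<open>Dop lam\<close> is a bijection of \<open>Vsp 1\<close> onto itself.\<close>

definition Dinv :: "complex ^ 'n \<Rightarrow> 'n::finite vfps \<Rightarrow> 'n vfps" where
  "Dinv lam = inv_into (Vsp 1) (Dop lam)"

definition Omega :: "complex ^ 'n \<Rightarrow> int ^ 'n \<Rightarrow> complex ^ 'n ^ 'n" where
  "Omega lam \<nu> = diag (\<chi> i. lampow lam \<nu> - lam $ i)"

text \<open>The product \<open>x \<cdot> \<beta>\<close> is bilinear; the library's inner product on \<open>complex ^ 'n\<close> is not.\<close>

definition cdot :: "complex ^ 'n \<Rightarrow> nat ^ 'n \<Rightarrow> complex" where
  "cdot x \<beta> = (\<Sum>i\<in>UNIV. x $ i * of_nat (\<beta> $ i))"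

section \<open>Labeled rooted trees\<close>

text \<open>\<open>LNode \<alpha> \<beta> ts\<close>: the root \<open>v\<close> carries \<open>\<alpha>\<^sub>v = \<alpha>\<close>, its exiting line carries \<open>\<beta>\<close>, and \<open>ts\<close> is the
  ordered list of the subtrees attached to \<open>v\<close>. A node of a tree, with its exiting line, is
  represented by the subtree whose root it is: \<open>subtrees\<close> then lists its children (that is, the lines
  of \<open>L\<^sub>v\<close>), and \<open>nodes\<close> lists the \<open>w \<le> v\<close>, one entry per node.\<close>

datatype 'n ltree =
  LNode (nlabel: "nat ^ 'n::finite") (llabel: "nat ^ 'n::finite") (subtrees: "'n ltree list")

primrec nodes :: "'n::finite ltree \<Rightarrow> 'n ltree list" where
  "nodes (LNode \<alpha> \<beta> ts) = LNode \<alpha> \<beta> ts # concat (map nodes ts)"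

definition betasum :: "'n::finite ltree \<Rightarrow> nat ^ 'n" where
  "betasum v = (\<Sum>w\<leftarrow>subtrees v. llabel w)"

definition momentum :: "'n::finite ltree \<Rightarrow> int ^ 'n" where
  "momentum v = (\<Sum>w\<leftarrow>nodes v. int_vec (nlabel w) - int_vec (betasum w))"

text \<open>The factor \<open>\<^bold>h\<^sup>\<beta> = \<Prod>\<^sub>i h\<^sub>i\<^bsup>\<beta>\<^sub>i\<^esup>\<close> of the Taylor expansion fixes only the order among lines that enter
  a node with the same label. The relative order of lines with different labels carries no
  information: counting the \<open>|\<beta>\<^sub>v|! / \<beta>\<^sub>v!\<close> interleavings separately would count terms repeatedly.
  The representative listing the lines labeled \<open>e\<^sub>i\<close> before those labeled \<open>e\<^sub>j\<close>, for \<open>i < j\<close>, is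
  used. For \<open>n = 1\<close> the condition is void.\<close>

definition canonical :: "'n::{finite,linorder} ltree \<Rightarrow> bool" where
  "canonical v \<longleftrightarrow>
     sorted_wrt (\<lambda>s t. \<forall>i j. llabel s = axis i 1 \<and> llabel t = axis j 1 \<longrightarrow> i \<le> j) (subtrees v)"

definition ltrees :: "nat \<Rightarrow> nat ^ 'n::{finite,linorder} \<Rightarrow> 'n \<Rightarrow> 'n ltree set" where
  "ltrees N \<alpha> j = {\<theta>. length (nodes \<theta>) = N \<and>
     (\<forall>v\<in>set (nodes \<theta>). msize (nlabel v) \<ge> 2 \<and> msize (llabel v) = 1 \<and> canonical v) \<and>
     momentum \<theta> = int_vec \<alpha> \<and> llabel \<theta> = axis j 1}"

end

theory Submission
  imports Defs
begin

text \<open>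
  The operator \<open>D\<^sub>\<lambda>\<close> is diagonal in the coefficients: it multiplies the coefficient of \<open>z\<^sup>\<alpha>\<close> in the
  \<open>j\<close>-th component by \<open>\<lambda>\<^sup>\<alpha> - \<lambda>\<^sub>j\<close>. Hence \<open>h = D\<^sub>\<lambda>\<^sup>-\<^sup>1 (f \<circ> (z + h))\<close> says that
  \<open>(\<lambda>\<^sup>\<alpha> - \<lambda>\<^sub>j) h\<^sub>\<alpha>\<^sub>j\<close> is the coefficient of \<open>z\<^sup>\<alpha>\<close> in
  \<open>\<Sum>\<^sub>a f\<^sub>a\<^sub>j \<Sum>\<^sub>b\<^sub>\<le>\<^sub>a (a choose b) z\<^sup>a\<^sup>-\<^sup>b h\<^sup>b\<close>, for all \<open>|\<alpha>| \<ge> 2\<close> and all \<open>j\<close>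
  (\<open>fixed_point_iff_coeffs\<close> and \<open>mcoeff_mpow_zid_plus\<close>).

  Since \<open>f\<close> starts in degree two, the right-hand side in degree \<open>m\<close> only involves coefficients of
  \<open>h\<close> in lower degrees, so there is at most one solution (\<open>fixed_point_unique\<close>).

  For existence, and for the formula, take as \<open>h\<close> the series whose coefficients are the sums over
  trees. The value of a tree is a product over its nodes, so it factors at the root into the factor of
  the root line, the binomial of the root, and the values of the subtrees (\<open>tree_val_rec\<close>). A power
  \<open>h\<^sup>b\<close> therefore enumerates lists of trees whose root lines have labels with sum \<open>b\<close>; sorting these
  labels selects exactly one list for each way of choosing one tree per factor of \<open>h\<^sup>b\<close>, which is what
  \<open>canonical\<close> expresses (\<open>canonical_forest_iff\<close>, \<open>mcoeff_mpow_tree_series\<close>). A tree is then the same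
  thing as a choice of \<open>a\<close>, \<open>b\<close> and such a list, and the factor of the root line is
  \<open>f\<^sub>a\<^sub>j / (\<lambda>\<^sup>\<alpha> - \<lambda>\<^sub>j)\<close>; so cutting off the root turns the sum over trees into the right-hand side
  above (\<open>mcoeff_tree_series_root\<close>).

  Two points need care. A momentum may have negative entries, where non-resonance says nothing about
  \<open>\<Omega>\<close>; but then some binomial of the tree vanishes, so the argument can be carried out with the trees
  all of whose binomials are nonzero, whose momenta are multi-indices of size at least two. And the
  sums over trees are finite: since every node has \<open>|\<alpha>\<^sub>v| \<ge> 2\<close> and every line lowers the degree by one,
  a tree of total momentum \<open>\<alpha>\<close> has fewer than \<open>|\<alpha>|\<close> nodes and bounded labels
  (\<open>ltrees_order_bound\<close>, \<open>finite_ltrees\<close>).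
\<close>

section \<open>Multi-indices\<close>

lemma msize_zero [simp]: "msize 0 = 0"
  by (simp add: msize_def)

lemma msize_add [simp]: "msize (a + b) = msize a + msize b"
  by (simp add: msize_def sum.distrib)

lemma msize_axis [simp]: "msize (axis i x) = x"
  by (simp add: msize_def axis_def)

lemma msize_sum_list: "msize (\<Sum>x\<leftarrow>xs. f x) = (\<Sum>x\<leftarrow>xs. msize (f x))"
  by (induction xs) auto

lemma mindex_le_add_diff: "b \<le> a \<Longrightarrow> b + (a - b) = (a :: nat ^ 'n)"
  by (simp add: vec_eq_iff less_eq_vec_def)

lemma mindex_le_add [simp]: "a \<le> a + (b :: nat ^ 'n)"
  by (simp add: less_eq_vec_def)

lemma msize_diff:
  assumes "b \<le> a"
  shows "msize (a - b) = msize a - msize (b :: nat ^ 'n::finite)"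
  using msize_add[of b "a - b"] mindex_le_add_diff[OF assms] by simp

lemma msize_mono: "a \<le> b \<Longrightarrow> msize a \<le> msize (b :: nat ^ 'n::finite)"
  by (simp add: msize_def less_eq_vec_def sum_mono)

lemma msize_eq_0_iff: "msize (a :: nat ^ 'n::finite) = 0 \<longleftrightarrow> a = 0"
  by (simp add: msize_def vec_eq_iff)

lemma mindex_pos_split:
  assumes "a \<noteq> (0 :: nat ^ 'n::finite)"
  obtains i b where "a = b + axis i 1"
proof -
  from assms obtain i where "a $ i \<noteq> 0"
    by (auto simp: vec_eq_iff)
  then have "a = (a - axis i 1) + axis i 1"
    by (auto simp: vec_eq_iff axis_def)
  then show ?thesis
    by (rule that)
qed

lemma mindex_induct [case_names zero add_axis]:
  assumes "P (0 :: nat ^ 'n::finite)" and "\<And>a i. P a \<Longrightarrow> P (a + axis i 1)"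
  shows "P a"
proof (induction "msize a" arbitrary: a rule: less_induct)
  case less
  show ?case
  proof (cases "a = 0")
    case True
    then show ?thesis using assms(1) by simp
  next
    case False
    then obtain i b where "a = b + axis i 1"
      by (rule mindex_pos_split)
    then show ?thesis
      using less[of b] assms(2) by simp
  qed
qed

lemma msize_eq_1_iff: "msize (a :: nat ^ 'n::finite) = 1 \<longleftrightarrow> (\<exists>i. a = axis i 1)"
proof
  assume a: "msize a = 1"
  then have "a \<noteq> 0" by auto
  then obtain i b where "a = b + axis i 1"
    by (rule mindex_pos_split)
  with a show "\<exists>i. a = axis i 1"
    by (auto simp: msize_eq_0_iff)
qed auto

lemma finite_mindex_le: "finite {b. b \<le> (a :: nat ^ 'n::finite)}"
proof (rule finite_subset)
  show "{b. b \<le> a} \<subseteq> fst ` {(b, c). b + c = a}"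
    using mindex_le_add_diff by (force simp: image_iff)
qed (simp add: finite_mindex_splits)

lemma finite_msize_le: "finite {a :: nat ^ 'n::finite. msize a \<le> k}"
proof (rule finite_subset)
  have "a $ i \<le> msize a" for a :: "nat ^ 'n" and i
    unfolding msize_def by (rule member_le_sum) auto
  then show "{a :: nat ^ 'n. msize a \<le> k} \<subseteq> {a. a \<le> (\<chi> i. k)}"
    by (auto simp: less_eq_vec_def intro: order_trans)
qed (rule finite_mindex_le)

lemma axis_one_inject [simp]: "axis i (Suc 0) = axis j (Suc 0) \<longleftrightarrow> i = j"
  by (auto simp: axis_eq_axis)

text \<open>The \<open>i\<close>-th entry of a sum of unit vectors counts how often \<open>i\<close> occurs in the list of
  directions, so the sum determines the list up to order and hence the sorted list.\<close>

lemma sum_list_axis_nth: "(\<Sum>j\<leftarrow>js. axis j 1) $ i = count_list js i"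
  by (induction js) (auto simp: axis_def)

lemma sorted_axis_list_unique:
  fixes js ks :: "'n::{finite,linorder} list"
  assumes "sorted js" and "sorted ks" and "(\<Sum>j\<leftarrow>js. axis j (1::nat)) = (\<Sum>j\<leftarrow>ks. axis j 1)"
  shows "js = ks"
proof -
  have "count_list js i = count_list ks i" for i
    using assms(3) by (metis sum_list_axis_nth)
  then have "mset js = mset ks"
    by (simp add: multiset_eq_iff count_mset)
  then show ?thesis
    using assms(1,2) by (metis properties_for_sort)
qed

lemma sorted_axis_list_exists:
  obtains js :: "'n::{finite,linorder} list"
  where "sorted js" and "(\<Sum>j\<leftarrow>js. axis j 1) = (a :: nat ^ 'n::{finite,linorder})"
proof -
  have "\<exists>js. sorted js \<and> (\<Sum>j\<leftarrow>js. axis j 1) = a"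
  proof (induction a rule: mindex_induct)
    case zero
    then show ?case by (auto intro: exI[of _ "[]"])
  next
    case (add_axis a i)
    then obtain js where "sorted js" "(\<Sum>j\<leftarrow>js. axis j 1) = a" by blast
    moreover have "(\<Sum>j\<leftarrow>insort i js. axis j 1) = axis i 1 + (\<Sum>j\<leftarrow>js. axis j (1::nat))"
      by (induction js) (simp_all add: add.left_commute)
    ultimately have "sorted (insort i js) \<and> (\<Sum>j\<leftarrow>insort i js. axis j 1) = a + axis i 1"
      by (simp add: sorted_insort add.commute)
    then show ?case by blast
  qed
  then show ?thesis using that by blast
qed

lemma vfps_eqI: "(\<And>i a. mcoeff (g $ i) a = mcoeff (h $ i) a) \<Longrightarrow> g = h"
  by (metis mfps_eqI vec_eq_iff)

section \<open>Monomials and substitution in power series\<close>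

lemma mcoeff_simps [simp]:
  "mcoeff 0 c = 0"
  "mcoeff (a + b) c = mcoeff a c + mcoeff b c"
  "mcoeff (a - b) c = mcoeff a c - mcoeff b c"
  "mcoeff 1 c = (if c = 0 then 1 else 0)"
  by (simp_all add: zero_mfps.rep_eq plus_mfps.rep_eq minus_mfps.rep_eq one_mfps.rep_eq)

lemma mcoeff_times: "mcoeff (a * b) c = (\<Sum>(x, y) | x + y = c. mcoeff a x * mcoeff b y)"
  by (simp add: times_mfps.rep_eq)

lemma mcoeff_sum: "mcoeff (\<Sum>x\<in>S. g x) c = (\<Sum>x\<in>S. mcoeff (g x) c)"
  by (induction S rule: infinite_finite_induct) auto

lemma mcoeff_Abs_mfps [simp]: "mcoeff (Abs_mfps g) = g"
  by (simp add: Abs_mfps_inverse)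

definition monomial :: "complex \<Rightarrow> nat ^ 'n \<Rightarrow> 'n::finite mfps" where
  "monomial x a = Abs_mfps (\<lambda>c. if c = a then x else 0)"

lemma mcoeff_monomial: "mcoeff (monomial x a) c = (if c = a then x else 0)"
  by (simp add: monomial_def)

lemma mcoeff_monomial_times:
  "mcoeff (monomial x a * g) c = (if a \<le> c then x * mcoeff g (c - a) else 0)"
proof -
  have "mcoeff (monomial x a * g) c =
      (\<Sum>p | fst p + snd p = c. (if fst p = a then x else 0) * mcoeff g (snd p))"
    by (simp add: mcoeff_times mcoeff_monomial case_prod_unfold)
  also have "\<dots> = (\<Sum>p \<in> {p. p = (a, c - a) \<and> a \<le> c}. x * mcoeff g (snd p))"
  proof (rule sum.mono_neutral_cong_right)
    show "finite {p. fst p + snd p = c}"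
      using finite_mindex_splits[of c] by (simp add: case_prod_unfold)
  qed (auto simp: mindex_le_add_diff split: if_splits)
  also have "\<dots> = (if a \<le> c then x * mcoeff g (c - a) else 0)"
    by simp
  finally show ?thesis .
qed

lemma monomial_mult: "monomial x a * monomial y b = monomial (x * y) (a + b)"
  by (rule mfps_eqI)
    (auto simp: mcoeff_monomial_times mcoeff_monomial mindex_le_add_diff)

lemma monomial_zero: "monomial 1 0 = 1"
  by (rule mfps_eqI) (simp add: mcoeff_monomial)

lemma mfps_const_monomial: "mfps_const x = monomial x 0"
  by (rule mfps_eqI) (simp add: mcoeff_monomial mfps_const.rep_eq)

lemma mfps_var_monomial: "mfps_var i = monomial 1 (axis i 1)"
  by (rule mfps_eqI) (simp add: mcoeff_monomial mfps_var.rep_eq)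

lemma mpow_zero [simp]: "mpow g 0 = 1"
  by (simp add: mpow_def)

lemma mpow_add: "mpow g (a + b) = mpow g a * mpow g b"
  by (simp add: mpow_def power_add prod.distrib)

lemma mpow_axis [simp]: "mpow g (axis i (Suc 0)) = g $ i"
proof -
  have "mpow g (axis i (Suc 0)) = (\<Prod>j\<in>UNIV. if j = i then g $ j else 1)"
    unfolding mpow_def by (rule prod.cong) (auto simp: axis_def)
  then show ?thesis by simp
qed

lemma mpow_sum_list_axis: "mpow g (\<Sum>j\<leftarrow>js. axis j 1) = (\<Prod>j\<leftarrow>js. g $ j)"
  by (induction js) (simp_all add: mpow_add)

lemma mpow_scaled_zid:
  "mpow (\<chi> i. monomial (c $ i) (axis i 1)) a = monomial (\<Prod>i\<in>UNIV. c $ i ^ (a $ i)) a"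
proof (induction a rule: mindex_induct)
  case zero
  show ?case by (simp add: monomial_zero)
next
  case (add_axis a i)
  have "(\<Prod>j\<in>UNIV. c $ j ^ (a + axis i 1) $ j) =
      (\<Prod>j\<in>UNIV. c $ j ^ (a $ j)) * (\<Prod>j\<in>UNIV. if j = i then c $ j else 1)"
    unfolding prod.distrib[symmetric]
    by (rule prod.cong) (auto simp: axis_def power_add)
  also have "(\<Prod>j\<in>UNIV. if j = i then c $ j else 1) = c $ i"
    by simp
  finally show ?case
    using add_axis by (simp only: mpow_add monomial_mult mpow_axis One_nat_def vec_lambda_beta mult_1_right)
qed

lemma mpow_zid: "mpow zid a = monomial 1 a"
  using mpow_scaled_zid[of "\<chi> i. 1" a] by (simp add: zid_def mfps_var_monomial)

lemma mbinom_prod: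
  assumes "b \<le> a"
  shows "mbinom a b = (\<Prod>i\<in>UNIV. of_nat ((a $ i) choose (b $ i)))"
proof -
  have le: "b $ i \<le> a $ i" for i
    using assms by (simp add: less_eq_vec_def)
  have "(\<Prod>i\<in>UNIV. of_nat ((a $ i) choose (b $ i))) =
      (\<Prod>i\<in>UNIV. fact (a $ i) / (fact (b $ i) * fact (a $ i - b $ i)) :: complex)"
    by (simp only: binomial_fact[OF le])
  also have "\<dots> = mbinom a b"
    using le by (simp add: mbinom_def mfact_def prod_dividef prod.distrib)
  finally show ?thesis by simp
qed

text \<open>The one-variable binomial theorems for the factors \<open>(g\<^sub>i + h\<^sub>i)\<close> to the power \<open>a\<^sub>i\<close>, multiplied
  out: a choice of one summand in each factor is a multi-index \<open>b \<le> a\<close>.\<close>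

lemma mpow_add_binomial:
  "mpow (g + h) a = (\<Sum>b | b \<le> a. mfps_const (mbinom a b) * mpow g (a - b) * mpow h b)"
proof -
  have const_nat: "mfps_const (of_nat k) = (of_nat k :: 'a mfps)" for k
  proof (induction k)
    case 0
    show ?case
      by (rule mfps_eqI) (simp add: mfps_const.rep_eq)
  next
    case (Suc k)
    have "mfps_const (of_nat (Suc k)) = 1 + (mfps_const (of_nat k) :: 'a mfps)"
      by (rule mfps_eqI) (simp add: mfps_const.rep_eq)
    with Suc show ?case by (simp only: of_nat_Suc)
  qed
  have const_prod: "mfps_const (\<Prod>i\<in>I. u i) = (\<Prod>i\<in>I. mfps_const (u i) :: 'a mfps)"
    if "finite I" for u :: "'a \<Rightarrow> complex" and I
    using that
  proof (induction I rule: finite_induct)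
    case (insert i I)
    have "mfps_const (u i * prod u I) = mfps_const (u i) * (mfps_const (prod u I) :: 'a mfps)"
      by (simp add: mfps_const_monomial monomial_mult)
    with insert show ?case by simp
  qed (simp add: mfps_const_monomial monomial_zero)
  \<comment> \<open>the \<open>k\<close>-th summand of the \<open>i\<close>-th binomial expansion\<close>
  define t where "t = (\<lambda>i k. of_nat ((a $ i) choose k) * g $ i ^ (a $ i - k) * h $ i ^ k)"
  have "mpow (g + h) a = (\<Prod>i\<in>UNIV. \<Sum>k\<le>a $ i. t i k)"
  proof -
    have "(g $ i + h $ i) ^ (a $ i) = (\<Sum>k\<le>a $ i. t i k)" for i
    proof -
      have "(h $ i + g $ i) ^ (a $ i) = (\<Sum>k\<le>a $ i. t i k)"
        by (subst binomial_ring) (simp only: t_def mult.assoc mult.commute[of "h $ i ^ _"])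
      then show ?thesis by (simp only: add.commute[of "g $ i"])
    qed
    then show ?thesis by (simp add: mpow_def)
  qed
  also have "\<dots> = (\<Sum>k\<in>PiE UNIV (\<lambda>i. {..a $ i}). \<Prod>i\<in>UNIV. t i (k i))"
    by (rule prod_sum_PiE) auto
  also have "\<dots> = (\<Sum>b | b \<le> a. \<Prod>i\<in>UNIV. t i (b $ i))"
    by (rule sum.reindex_bij_witness[where i = vec_nth and j = "\<lambda>k. \<chi> i. k i"])
      (auto simp: less_eq_vec_def)
  also have "\<dots> = (\<Sum>b | b \<le> a. mfps_const (mbinom a b) * mpow g (a - b) * mpow h b)"
  proof (rule sum.cong[OF refl])
    fix b assume "b \<in> {b. b \<le> a}"
    then have "mfps_const (mbinom a b) = (\<Prod>i\<in>UNIV. of_nat ((a $ i) choose (b $ i)) :: 'a mfps)"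
      by (simp add: mbinom_prod const_prod const_nat)
    then show "(\<Prod>i\<in>UNIV. t i (b $ i)) = mfps_const (mbinom a b) * mpow g (a - b) * mpow h b"
      by (simp only: t_def mpow_def prod.distrib vector_minus_component)
  qed
  finally show ?thesis .
qed

lemma mcoeff_mpow_zid_plus:
  "mcoeff (mpow (zid + h) a) c =
    (\<Sum>b | b \<le> a. if a - b \<le> c then mbinom a b * mcoeff (mpow h b) (c - (a - b)) else 0)"
  unfolding mpow_add_binomial mcoeff_sum
  by (rule sum.cong)
    (simp_all add: mpow_zid mfps_const_monomial monomial_mult mcoeff_monomial_times)

section \<open>Order of vanishing\<close>


definition vanishes_below :: "nat \<Rightarrow> 'n::finite mfps \<Rightarrow> bool" where
  "vanishes_below k u \<longleftrightarrow> (\<forall>a. msize a < k \<longrightarrow> mcoeff u a = 0)"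

lemma vanishes_below_0 [simp]: "vanishes_below 0 u"
  by (simp add: vanishes_below_def)

lemma vanishes_below_add: "vanishes_below k u \<Longrightarrow> vanishes_below k w \<Longrightarrow> vanishes_below k (u + w)"
  by (simp add: vanishes_below_def)

lemma vanishes_below_mult:
  assumes "vanishes_below k u" and "vanishes_below l w"
  shows "vanishes_below (k + l) (u * w)"
  unfolding vanishes_below_def
proof (intro allI impI)
  fix a :: "nat ^ 'a"
  assume a: "msize a < k + l"
  have "mcoeff u x * mcoeff w y = 0" if "x + y = a" for x y
  proof -
    have "msize x < k \<or> msize y < l"
      using a that by auto
    then show ?thesis
      using assms by (auto simp: vanishes_below_def)
  qed
  then show "mcoeff (u * w) a = 0"
    by (auto simp: mcoeff_times intro!: sum.neutral)
qed

lemma vanishes_below_mpow: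
  assumes "\<And>i. vanishes_below 1 (g $ i)"
  shows "vanishes_below (msize a) (mpow g a)"
proof (induction a rule: mindex_induct)
  case (add_axis a i)
  then show ?case
    using vanishes_below_mult[OF add_axis assms[of i]] by (simp add: mpow_add)
qed simp

text \<open>Replacing \<open>g\<close> by \<open>g'\<close> in one factor of \<open>g\<^sup>a\<close> changes the product by the difference, of order
  at least \<open>m\<close>, times \<open>|a| - 1\<close> further factors without constant term.\<close>

lemma vanishes_below_mpow_diff:
  assumes g: "\<And>i. vanishes_below 1 (g $ i)" and g': "\<And>i. vanishes_below 1 (g' $ i)"
    and diff: "\<And>i. vanishes_below m (g $ i - g' $ i)" and "m \<ge> 1"
  shows "vanishes_below (m + msize a - 1) (mpow g a - mpow g' a)"
proof (induction a rule: mindex_induct)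
  case zero
  show ?case by (simp add: vanishes_below_def)
next
  case (add_axis a i)
  have "mpow g (a + axis i 1) - mpow g' (a + axis i 1) =
      (g $ i - g' $ i) * mpow g a + g' $ i * (mpow g a - mpow g' a)"
    by (simp add: mpow_add algebra_simps)
  moreover have "vanishes_below (m + msize a) ((g $ i - g' $ i) * mpow g a)"
    by (intro vanishes_below_mult diff vanishes_below_mpow g)
  moreover have "vanishes_below (1 + (m + msize a - 1)) (g' $ i * (mpow g a - mpow g' a))"
    by (intro vanishes_below_mult g' add_axis)
  ultimately show ?case
    using \<open>m \<ge> 1\<close> by (simp add: vanishes_below_add)
qed

lemma Vsp_iff: "f \<in> Vsp k \<longleftrightarrow> (\<forall>i. vanishes_below (Suc k) (f $ i))"
proof -
  have "enat k < vord f \<longleftrightarrow> (\<forall>a. vcoeff f a \<noteq> 0 \<longrightarrow> k < msize a)"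
  proof
    assume "enat k < vord f"
    then show "\<forall>a. vcoeff f a \<noteq> 0 \<longrightarrow> k < msize a"
      unfolding vord_def by (auto simp: dest!: less_INF_D)
  next
    assume R: "\<forall>a. vcoeff f a \<noteq> 0 \<longrightarrow> k < msize a"
    have "enat (Suc k) \<le> vord f"
      unfolding vord_def by (rule INF_greatest) (use R in auto)
    then show "enat k < vord f"
      by (meson enat_ord_simps(2) lessI less_le_trans)
  qed
  also have "\<dots> \<longleftrightarrow> (\<forall>i. vanishes_below (Suc k) (f $ i))"
    by (auto simp: vanishes_below_def vcoeff_def vec_eq_iff not_less less_Suc_eq_le) (metis not_le)+
  finally show ?thesis by (simp add: Vsp_def)
qed

lemma vanishes_below_zid_plus:
  assumes "h \<in> Vsp 1"
  shows "vanishes_below 1 ((zid + h) $ i)"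
proof -
  have "vanishes_below 1 (mfps_var i)"
    by (auto simp: vanishes_below_def mfps_var_monomial mcoeff_monomial)
  moreover have "vanishes_below 1 (h $ i)"
    using assms by (auto simp: Vsp_iff vanishes_below_def)
  ultimately show ?thesis
    by (simp add: zid_def vanishes_below_add)
qed

section \<open>The linear operator and the fixed-point equation\<close>

text \<open>The formal sum defining the composition is finite in every degree, since the \<open>a\<close>-th power of
  a family without constant terms has order at least \<open>|a|\<close>.\<close>

lemma mcoeff_vcomp:
  assumes "\<And>i. vanishes_below 1 (g $ i)"
  shows "mcoeff ((f \<circ>\<^sub>V g) $ j) c =
    (\<Sum>a | msize a \<le> msize c. mcoeff (f $ j) a * mcoeff (mpow g a) c)"
proof -
  have "mcoeff (mpow g a) c = 0" if "\<not> msize a \<le> msize c" for a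
    using vanishes_below_mpow[OF assms, of a] that by (auto simp: vanishes_below_def)
  then show ?thesis
    unfolding vcomp_def
    by (auto intro!: Sum_any.expand_superset finite_msize_le) blast
qed

lemma matact_diag: "matact (diag lam) g = (\<chi> i. mfps_const (lam $ i) * g $ i)"
proof -
  have "(\<Sum>j\<in>UNIV. mfps_const (diag lam $ i $ j) * g $ j) =
      (\<Sum>j\<in>UNIV. if i = j then mfps_const (lam $ i) * g $ j else 0)" for i
    by (rule sum.cong)
      (auto simp: diag_def intro!: mfps_eqI simp: mfps_const_monomial mcoeff_monomial_times)
  then show ?thesis
    by (simp add: matact_def vec_eq_iff)
qed

lemma lampow_int_vec: "lampow lam (int_vec a) = (\<Prod>i\<in>UNIV. lam $ i ^ (a $ i))"
  by (simp add: lampow_def int_vec_def)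

text \<open>Substituting \<open>\<lambda>\<^sub>i z\<^sub>i\<close> for \<open>z\<^sub>i\<close> turns the monomial \<open>z\<^sup>a\<close> into \<open>\<lambda>\<^sup>a z\<^sup>a\<close>.\<close>

lemma mcoeff_Dop:
  "mcoeff (Dop lam g $ i) a = (lampow lam (int_vec a) - lam $ i) * mcoeff (g $ i) a"
proof -
  have "mpow (matact (diag lam) zid) b = monomial (lampow lam (int_vec b)) b" for b
    using mpow_scaled_zid[of lam b]
    by (simp add: matact_diag zid_def mfps_const_monomial mfps_var_monomial monomial_mult
        lampow_int_vec)
  then have "mcoeff ((g \<circ>\<^sub>V matact (diag lam) zid) $ i) a =
      Sum_any (\<lambda>b. mcoeff (g $ i) b * (if a = b then lampow lam (int_vec b) else 0))"
    by (simp add: vcomp_def mcoeff_monomial)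
  also have "\<dots> = mcoeff (g $ i) a * lampow lam (int_vec a)"
    by (subst Sum_any.expand_superset[of "{a}"]) auto
  finally have "mcoeff ((g \<circ>\<^sub>V matact (diag lam) zid) $ i) a =
      mcoeff (g $ i) a * lampow lam (int_vec a)" .
  moreover have "mcoeff (matact (diag lam) g $ i) a = lam $ i * mcoeff (g $ i) a"
    by (simp add: matact_diag mfps_const_monomial mcoeff_monomial_times less_eq_vec_def)
  ultimately show ?thesis
    by (simp add: Dop_def algebra_simps)
qed

lemma bij_betw_Dop:
  assumes "nonresonant lam"
  shows "bij_betw (Dop lam) (Vsp 1) (Vsp 1)"
proof (rule bij_betwI')
  have nz: "lampow lam (int_vec a) - lam $ i \<noteq> 0" if "\<not> msize a < 2" for a i
    using assms that by (auto simp: nonresonant_def)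
  fix g h :: "'a vfps"
  assume g: "g \<in> Vsp 1"
  show "Dop lam g \<in> Vsp 1"
    using g by (simp add: Vsp_iff vanishes_below_def mcoeff_Dop)
  define k :: "'a vfps"
    where "k = (\<chi> i. Abs_mfps (\<lambda>a. mcoeff (g $ i) a / (lampow lam (int_vec a) - lam $ i)))"
  have "k \<in> Vsp 1"
    using g by (simp add: k_def Vsp_iff vanishes_below_def)
  moreover have "Dop lam k = g"
  proof -
    have "mcoeff (Dop lam k $ i) a = mcoeff (g $ i) a" for i a
    proof (cases "msize a < 2")
      case True
      then show ?thesis
        using g by (simp add: k_def mcoeff_Dop Vsp_iff vanishes_below_def)
    next
      case False
      then show ?thesis
        using nz[OF False, of i] by (simp add: k_def mcoeff_Dop)
    qed
    then show ?thesis
      by (rule vfps_eqI)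
  qed
  ultimately show "\<exists>k\<in>Vsp 1. g = Dop lam k"
    by blast
  assume h: "h \<in> Vsp 1"
  have "mcoeff (g $ i) a = mcoeff (h $ i) a" if "Dop lam g = Dop lam h" for i a
  proof (cases "msize a < 2")
    case True
    then show ?thesis
      using g h by (simp add: Vsp_iff vanishes_below_def)
  next
    case False
    then show ?thesis
      using nz[OF False, of i] arg_cong[OF that, of "\<lambda>u. mcoeff (u $ i) a"]
      by (simp add: mcoeff_Dop)
  qed
  then show "Dop lam g = Dop lam h \<longleftrightarrow> g = h"
    using vfps_eqI by blast
qed

lemma vcomp_in_Vsp:
  assumes "f \<in> Vsp 1" and "h \<in> Vsp 1"
  shows "f \<circ>\<^sub>V (zid + h) \<in> Vsp 1"
  using assms(1) unfolding Vsp_iff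
  by (auto simp: vanishes_below_def mcoeff_vcomp[OF vanishes_below_zid_plus[OF assms(2)]]
      intro!: sum.neutral)

lemma fixed_point_iff_coeffs:
  assumes "nonresonant lam" and "f \<in> Vsp 1" and "h \<in> Vsp 1"
  shows "h = Dinv lam (f \<circ>\<^sub>V (zid + h)) \<longleftrightarrow>
    (\<forall>a j. msize a \<ge> 2 \<longrightarrow>
      (lampow lam (int_vec a) - lam $ j) * mcoeff (h $ j) a = mcoeff ((f \<circ>\<^sub>V (zid + h)) $ j) a)"
proof -
  let ?F = "f \<circ>\<^sub>V (zid + h)"
  have F: "?F \<in> Vsp 1"
    by (rule vcomp_in_Vsp[OF assms(2,3)])
  note bij = bij_betw_Dop[OF assms(1)]
  have "h = Dinv lam ?F \<longleftrightarrow> Dop lam h = ?F"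
    unfolding Dinv_def
    using bij_betw_inv_into_left[OF bij assms(3)] bij_betw_inv_into_right[OF bij F] by metis
  also have "\<dots> \<longleftrightarrow> (\<forall>j a. mcoeff (Dop lam h $ j) a = mcoeff (?F $ j) a)"
    by (auto intro: vfps_eqI)
  also have "\<dots> \<longleftrightarrow> (\<forall>j a. msize a \<ge> 2 \<longrightarrow> mcoeff (Dop lam h $ j) a = mcoeff (?F $ j) a)"
  proof -
    have "mcoeff (Dop lam h $ j) a = mcoeff (?F $ j) a" if "\<not> msize a \<ge> 2" for j a
      using F assms(3) that by (simp add: mcoeff_Dop Vsp_iff vanishes_below_def)
    then show ?thesis by blast
  qed
  finally show ?thesis
    by (auto simp: mcoeff_Dop)
qed

text \<open>Since \<open>f\<close> has no terms of degree below two, the coefficients of \<open>f \<circ> (z + h)\<close> in degree \<open>m\<close>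
  only involve coefficients of \<open>h\<close> in degrees below \<open>m\<close>. The equation therefore determines \<open>h\<close>
  degree by degree.\<close>

lemma fixed_point_unique:
  assumes "nonresonant lam" and f: "f \<in> Vsp 1"
    and h: "h \<in> Vsp 1" "h = Dinv lam (f \<circ>\<^sub>V (zid + h))"
    and k: "k \<in> Vsp 1" "k = Dinv lam (f \<circ>\<^sub>V (zid + k))"
  shows "h = k"
proof -
  have agree: "vanishes_below m (h $ i - k $ i)" for m i
  proof (induction m arbitrary: i)
    case (Suc m)
    have "mcoeff (h $ i) c = mcoeff (k $ i) c" if "msize c = m" for c
    proof (cases "m \<ge> 2")
      case False
      then show ?thesis
        using h(1) k(1) that by (simp add: Vsp_iff vanishes_below_def)
    next
      case True
      have "mcoeff (f $ i) a * mcoeff (mpow (zid + h) a) c =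
          mcoeff (f $ i) a * mcoeff (mpow (zid + k) a) c" for a
      proof (cases "msize a \<ge> 2")
        case False
        then show ?thesis
          using f by (simp add: Vsp_iff vanishes_below_def)
      next
        case a: True
        have "vanishes_below (m + msize a - 1) (mpow (zid + h) a - mpow (zid + k) a)"
          using True Suc
          by (intro vanishes_below_mpow_diff vanishes_below_zid_plus h(1) k(1)) auto
        then show ?thesis
          using a \<open>msize c = m\<close> by (simp add: vanishes_below_def)
      qed
      then have "mcoeff ((f \<circ>\<^sub>V (zid + h)) $ i) c = mcoeff ((f \<circ>\<^sub>V (zid + k)) $ i) c"
        by (simp only: mcoeff_vcomp[OF vanishes_below_zid_plus[OF h(1)]]
            mcoeff_vcomp[OF vanishes_below_zid_plus[OF k(1)]])
      then have "(lampow lam (int_vec c) - lam $ i) * mcoeff (h $ i) c =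
          (lampow lam (int_vec c) - lam $ i) * mcoeff (k $ i) c"
        using h(2) k(2) True \<open>msize c = m\<close>
        by (simp add: fixed_point_iff_coeffs[OF assms(1) f h(1)]
            fixed_point_iff_coeffs[OF assms(1) f k(1)])
      then show ?thesis
        using assms(1) True \<open>msize c = m\<close> by (auto simp: nonresonant_def)
    qed
    with Suc show ?case
      by (auto simp: vanishes_below_def less_Suc_eq)
  qed simp
  show ?thesis
  proof (rule vfps_eqI)
    fix i c
    show "mcoeff (h $ i) c = mcoeff (k $ i) c"
      using agree[of "Suc (msize c)" i] by (simp add: vanishes_below_def)
  qed
qed

section \<open>Generating functions of weighted families\<close>

text \<open>The family \<open>S\<close> is encoded by the series \<open>\<Sum>\<^sub>x v\<^sub>x z\<^bsup>mu x\<^esup>\<close>. This is meaningful when every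
  exponent is attained only finitely often; the default value \<open>0\<close> of an infinite sum never enters.\<close>

definition gf :: "'a set \<Rightarrow> ('a \<Rightarrow> nat ^ 'n) \<Rightarrow> ('a \<Rightarrow> complex) \<Rightarrow> 'n::finite mfps" where
  "gf S mu v = Abs_mfps (\<lambda>c. \<Sum>x | x \<in> S \<and> mu x = c. v x)"

definition finite_fibers :: "'a set \<Rightarrow> ('a \<Rightarrow> 'b) \<Rightarrow> bool" where
  "finite_fibers S mu \<longleftrightarrow> (\<forall>c. finite {x. x \<in> S \<and> mu x = c})"

lemma mcoeff_gf: "mcoeff (gf S mu v) c = (\<Sum>x | x \<in> S \<and> mu x = c. v x)"
  by (simp add: gf_def)

lemma finite_fibers_reindex:
  assumes "bij_betw p S T" and "\<And>x. x \<in> S \<Longrightarrow> nu (p x) = mu x" and "finite_fibers S mu"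
  shows "finite_fibers T nu"
  unfolding finite_fibers_def
proof
  fix c
  have "{y. y \<in> T \<and> nu y = c} \<subseteq> p ` {x. x \<in> S \<and> mu x = c}"
    using assms(1,2) by (auto simp: bij_betw_def image_iff)
  then show "finite {y. y \<in> T \<and> nu y = c}"
    by (rule finite_subset) (use assms(3) in \<open>simp add: finite_fibers_def\<close>)
qed

lemma gf_reindex:
  assumes p: "bij_betw p S T" and mu: "\<And>x. x \<in> S \<Longrightarrow> nu (p x) = mu x"
    and v: "\<And>x. x \<in> S \<Longrightarrow> w (p x) = v x"
  shows "gf S mu v = gf T nu w"
proof (rule mfps_eqI)
  fix c
  have "bij_betw p {x. x \<in> S \<and> mu x = c} {y. y \<in> T \<and> nu y = c}"
    using p mu by (auto simp: bij_betw_def inj_on_def image_iff)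
  from sum.reindex_bij_betw[OF this, of w]
  show "mcoeff (gf S mu v) c = mcoeff (gf T nu w) c"
    unfolding mcoeff_gf using v by (metis (mono_tags, lifting) mem_Collect_eq sum.cong)
qed

lemma
  assumes "finite_fibers S mu" and "finite_fibers T nu"
  shows finite_fibers_times: "finite_fibers (S \<times> T) (\<lambda>(x, y). mu x + nu y :: nat ^ 'n::finite)"
    and gf_times: "gf S mu v * gf T nu w =
      gf (S \<times> T) (\<lambda>(x, y). mu x + nu y) (\<lambda>(x, y). v x * w y)"
proof -
  define X where "X a = {x. x \<in> S \<and> mu x = a}" for a
  define Y where "Y b = {y. y \<in> T \<and> nu y = b}" for b
  have fin: "finite (X a)" "finite (Y b)" for a b
    using assms by (simp_all add: X_def Y_def finite_fibers_def)
  define P where "P c = {p :: (nat ^ 'n) \<times> (nat ^ 'n). fst p + snd p = c}" for c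
  have finP: "finite (P c)" for c
    using finite_mindex_splits[of c] by (simp add: P_def case_prod_unfold)
  let ?Z = "\<lambda>c. {z. z \<in> S \<times> T \<and> mu (fst z) + nu (snd z) = c}"
  have "?Z c \<subseteq> (\<Union>p\<in>P c. X (fst p) \<times> Y (snd p))" for c
    by (auto simp: X_def Y_def P_def)
  then have "finite (?Z c)" for c
    by (rule finite_subset) (intro finite_UN_I finP finite_SigmaI fin)
  then show "finite_fibers (S \<times> T) (\<lambda>(x, y). mu x + nu y)"
    by (simp add: finite_fibers_def case_prod_unfold)
  show "gf S mu v * gf T nu w = gf (S \<times> T) (\<lambda>(x, y). mu x + nu y) (\<lambda>(x, y). v x * w y)"
  proof (rule mfps_eqI)
    fix c
    have "mcoeff (gf S mu v * gf T nu w) c =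
        (\<Sum>p\<in>P c. (\<Sum>x\<in>X (fst p). v x) * (\<Sum>y\<in>Y (snd p). w y))"
      by (simp add: mcoeff_times mcoeff_gf P_def X_def Y_def case_prod_unfold)
    also have "\<dots> = (\<Sum>p\<in>P c. \<Sum>z\<in>X (fst p) \<times> Y (snd p). v (fst z) * w (snd z))"
      by (simp add: sum_product sum.cartesian_product case_prod_unfold)
    also have "\<dots> = (\<Sum>q\<in>Sigma (P c) (\<lambda>p. X (fst p) \<times> Y (snd p)).
        v (fst (snd q)) * w (snd (snd q)))"
      by (subst sum.Sigma) (auto simp: finP fin case_prod_unfold)
    also have "\<dots> = (\<Sum>z\<in>?Z c. v (fst z) * w (snd z))"
      by (rule sum.reindex_bij_witness
          [where j = snd and i = "\<lambda>z. ((mu (fst z), nu (snd z)), z)"])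
        (auto simp: P_def X_def Y_def)
    finally show "mcoeff (gf S mu v * gf T nu w) c =
        mcoeff (gf (S \<times> T) (\<lambda>(x, y). mu x + nu y) (\<lambda>(x, y). v x * w y)) c"
      by (simp add: mcoeff_gf case_prod_unfold)
  qed
qed

section \<open>Trees without vanishing binomials\<close>

lemma nodes_eq: "nodes t = t # concat (map nodes (subtrees t))"
  by (cases t) simp

lemma nodes_nonempty [simp]: "nodes t \<noteq> []"
  by (subst nodes_eq) simp

lemma nodes_ge_1: "1 \<le> length (nodes t)"
  by (simp add: Suc_le_eq)

definition well_labeled :: "'n::{finite,linorder} ltree \<Rightarrow> bool" where
  "well_labeled t \<longleftrightarrow>
    (\<forall>v\<in>set (nodes t). msize (nlabel v) \<ge> 2 \<and> msize (llabel v) = 1 \<and> canonical v)"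

text \<open>A well-labeled tree that is not effective contains a vanishing binomial and contributes nothing
  to the sums. On effective trees the subtractions \<open>\<alpha>\<^sub>v - \<beta>\<^sub>v\<close> can be carried out in the natural numbers.\<close>

definition effective :: "'n::{finite,linorder} ltree \<Rightarrow> bool" where
  "effective t \<longleftrightarrow> well_labeled t \<and> (\<forall>v\<in>set (nodes t). betasum v \<le> nlabel v)"

definition nmomentum :: "'n::finite ltree \<Rightarrow> nat ^ 'n" where
  "nmomentum t = (\<Sum>v\<leftarrow>nodes t. nlabel v - betasum v)"

lemma well_labeled_iff:
  "well_labeled t \<longleftrightarrow> msize (nlabel t) \<ge> 2 \<and> msize (llabel t) = 1 \<and> canonical t \<and>
    (\<forall>s\<in>set (subtrees t). well_labeled s)"
  unfolding well_labeled_def by (subst nodes_eq) auto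

lemma effective_iff:
  "effective t \<longleftrightarrow> msize (nlabel t) \<ge> 2 \<and> msize (llabel t) = 1 \<and> canonical t \<and>
    betasum t \<le> nlabel t \<and> (\<forall>s\<in>set (subtrees t). effective s)"
  unfolding effective_def well_labeled_def by (subst (1 2) nodes_eq) auto

lemma sum_list_concat_map: "(\<Sum>x\<leftarrow>concat xss. g x) = (\<Sum>xs\<leftarrow>xss. \<Sum>x\<leftarrow>xs. g x)"
  by (induction xss) auto

lemma momentum_rec:
  "momentum t = int_vec (nlabel t) - int_vec (betasum t) + (\<Sum>s\<leftarrow>subtrees t. momentum s)"
  unfolding momentum_def by (subst nodes_eq) (simp add: sum_list_concat_map comp_def)

lemma nmomentum_rec:
  "nmomentum t = nlabel t - betasum t + (\<Sum>s\<leftarrow>subtrees t. nmomentum s)"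
  unfolding nmomentum_def by (subst nodes_eq) (simp add: sum_list_concat_map comp_def)

lemma int_vec_inject [simp]: "int_vec a = int_vec b \<longleftrightarrow> a = b"
  by (auto simp: int_vec_def vec_eq_iff)

lemma int_vec_add: "int_vec (a + b) = int_vec a + int_vec b"
  by (simp add: int_vec_def vec_eq_iff)

lemma int_vec_sum_list: "int_vec (\<Sum>x\<leftarrow>xs. g x) = (\<Sum>x\<leftarrow>xs. int_vec (g x))"
  by (induction xs) (simp add: int_vec_def vec_eq_iff, simp add: int_vec_add)

lemma int_vec_diff: "b \<le> a \<Longrightarrow> int_vec (a - b) = int_vec a - int_vec b"
  by (simp add: int_vec_def vec_eq_iff less_eq_vec_def of_nat_diff)

lemma momentum_effective:
  assumes "effective t"
  shows "momentum t = int_vec (nmomentum t)"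
proof -
  have "(\<Sum>v\<leftarrow>nodes t. int_vec (nlabel v) - int_vec (betasum v)) =
      (\<Sum>v\<leftarrow>nodes t. int_vec (nlabel v - betasum v))"
    using assms by (intro arg_cong[of _ _ sum_list] map_cong) (auto simp: effective_def int_vec_diff)
  then show ?thesis
    by (simp add: momentum_def nmomentum_def int_vec_sum_list)
qed

lemma msize_diff_group: "msize (x - y) = msize x - msize (y :: 'a::ab_group_add ^ 'n)"
  by (simp add: msize_def sum_subtractf)

lemma msize_int_vec: "msize (int_vec a) = int (msize a)"
  by (simp add: msize_def int_vec_def)

lemma sum_list_ge_length: "(\<And>x. x \<in> set xs \<Longrightarrow> k \<le> g x) \<Longrightarrow> k * length xs \<le> (\<Sum>x\<leftarrow>xs. g x :: nat)"
  by (induction xs) (auto intro: add_mono)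

lemma msize_betasum:
  assumes "\<And>s. s \<in> set (subtrees t) \<Longrightarrow> msize (llabel s) = 1"
  shows "msize (betasum t) = length (subtrees t)"
proof -
  have "(\<Sum>s\<leftarrow>subtrees t. msize (llabel s)) = (\<Sum>s\<leftarrow>subtrees t. 1)"
    using assms by (intro arg_cong[of _ _ sum_list] map_cong) auto
  then show ?thesis
    by (simp add: betasum_def msize_sum_list sum_list_triv)
qed

text \<open>Each line entering a node lowers the degree by one, but the subtree from which it comes
  contributes at least two.\<close>

lemma msize_nlabel_le_nmomentum: "effective t \<Longrightarrow> msize (nlabel t) \<le> msize (nmomentum t)"
proof (induction t)
  case (LNode a b ts)
  define t where "t = LNode a b ts"
  have t: "effective t" "betasum t \<le> nlabel t"
    using LNode.prems effective_iff[of t] by (auto simp: t_def)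
  have "1 \<le> msize (nmomentum s)" if "s \<in> set ts" for s
    using LNode.IH[OF that] LNode.prems that effective_iff[of "LNode a b ts"] effective_iff[of s]
    by auto
  then have "length ts \<le> (\<Sum>s\<leftarrow>ts. msize (nmomentum s))"
    using sum_list_ge_length[of ts 1 "\<lambda>s. msize (nmomentum s)"] by simp
  moreover have "msize (betasum t) = length ts"
  proof -
    have "msize (llabel s) = 1" if "s \<in> set (subtrees t)" for s
      using t(1) that effective_iff[of t] effective_iff[of s] by blast
    then have "msize (betasum t) = length (subtrees t)"
      by (rule msize_betasum)
    then show ?thesis by (simp add: t_def)
  qed
  moreover have "msize (betasum t) \<le> msize (nlabel t)"
    by (rule msize_mono[OF t(2)])
  ultimately show ?case
    unfolding t_def[symmetric] nmomentum_rec[of t] msize_add msize_sum_list msize_diff[OF t(2)]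
    by (simp add: t_def)
qed

text \<open>Every node except the root is the lower end of exactly one line entering a node, so the labels
  \<open>\<beta>\<^sub>v\<close> have total size \<open>N - 1\<close>. Together with the momentum this fixes the total size of the
  \<open>\<alpha>\<^sub>v\<close>.\<close>

lemma sum_msize_nlabel:
  assumes "well_labeled t"
  shows "int (\<Sum>v\<leftarrow>nodes t. msize (nlabel v)) = msize (momentum t) + int (length (nodes t)) - 1"
  using assms
proof (induction t)
  case (LNode a b ts)
  define t where "t = LNode a b ts"
  have ts: "well_labeled s" "msize (llabel s) = 1" if "s \<in> set ts" for s
    using LNode.prems that well_labeled_iff[of "LNode a b ts"] well_labeled_iff[of s] by auto
  have "int (\<Sum>s\<leftarrow>ts. \<Sum>v\<leftarrow>nodes s. msize (nlabel v)) =
      (\<Sum>s\<leftarrow>ts. msize (momentum s)) + int (\<Sum>s\<leftarrow>ts. length (nodes s)) - int (length ts)"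
    using LNode.IH ts(1) by (induction ts) auto
  moreover have "int (msize (betasum t)) = int (length ts)"
    using msize_betasum[of t] ts(2) by (simp add: t_def)
  ultimately show ?case
    unfolding t_def[symmetric] momentum_rec[of t]
    by (simp add: nodes_eq[of t] msize_sum_list msize_diff_group msize_int_vec
        sum_list_concat_map comp_def length_concat) (simp add: t_def)
qed


text \<open>Induction on the number of nodes: each subtree of the root has fewer nodes than the whole tree,
  and the number of these subtrees is bounded as well.\<close>

lemma finite_trees:
  assumes "finite A" and "finite B"
  shows "finite {t. length (nodes t) \<le> N \<and> (\<forall>v\<in>set (nodes t). nlabel v \<in> A \<and> llabel v \<in> B)}"
proof (induction N)
  case 0
  have "{t. length (nodes t) \<le> 0 \<and> (\<forall>v\<in>set (nodes t). nlabel v \<in> A \<and> llabel v \<in> B)} = {}"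
    by simp
  then show ?case by simp
next
  case (Suc N)
  define T where
    "T N = {t. length (nodes t) \<le> N \<and> (\<forall>v\<in>set (nodes t). nlabel v \<in> A \<and> llabel v \<in> B)}" for N
  have "T (Suc N) \<subseteq> (\<lambda>(a, b, ts). LNode a b ts) ` (A \<times> B \<times> {ts. set ts \<subseteq> T N \<and> length ts \<le> N})"
  proof
    fix t assume t: "t \<in> T (Suc N)"
    obtain a b ts where ts: "t = LNode a b ts" by (cases t)
    have len: "(\<Sum>s\<leftarrow>ts. length (nodes s)) \<le> N"
      using t by (simp add: T_def ts length_concat comp_def)
    then have "length ts \<le> N"
      using sum_list_ge_length[of ts 1 "\<lambda>s. length (nodes s)", OF nodes_ge_1] by simp
    moreover have "set ts \<subseteq> T N"
    proof
      fix s assume s: "s \<in> set ts"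
      then have "length (nodes s) \<le> (\<Sum>s\<leftarrow>ts. length (nodes s))"
        by (intro member_le_sum_list) auto
      then show "s \<in> T N"
        using t s len by (auto simp: T_def ts)
    qed
    moreover have "a \<in> A" "b \<in> B"
      using t by (auto simp: T_def ts)
    ultimately show "t \<in> (\<lambda>(a, b, ts). LNode a b ts) ` (A \<times> B \<times> {ts. set ts \<subseteq> T N \<and> length ts \<le> N})"
      by (force simp: ts)
  qed
  moreover have "finite {ts. set ts \<subseteq> T N \<and> length ts \<le> N}"
    by (rule finite_lists_length_le) (use Suc in \<open>simp add: T_def\<close>)
  ultimately show ?case
    using assms by (fold T_def) (auto intro: finite_subset)
qed

lemma ltrees_iff:
  "t \<in> ltrees N c j \<longleftrightarrow>
    length (nodes t) = N \<and> well_labeled t \<and> momentum t = int_vec c \<and> llabel t = axis j 1"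
  by (auto simp: ltrees_def well_labeled_def)

lemma sum_msize_nlabel_ltrees:
  assumes "t \<in> ltrees N c j"
  shows "(\<Sum>v\<leftarrow>nodes t. msize (nlabel v)) + 1 = msize c + N"
  using assms sum_msize_nlabel[of t] by (simp add: ltrees_iff msize_int_vec)

text \<open>The \<open>N\<close> node labels have total size at least \<open>2N\<close> and exactly \<open>|c| + N - 1\<close>.\<close>

lemma ltrees_order_bound:
  assumes "t \<in> ltrees N c j"
  shows "N \<in> {1..msize c - 1}"
proof -
  have "2 * N \<le> (\<Sum>v\<leftarrow>nodes t. msize (nlabel v))"
    using assms sum_list_ge_length[of "nodes t" 2 "\<lambda>v. msize (nlabel v)"]
    by (auto simp: ltrees_iff well_labeled_def)
  then show ?thesis
    using sum_msize_nlabel_ltrees[OF assms] nodes_ge_1[of t] assms by (simp add: ltrees_iff)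
qed

lemma finite_ltrees: "finite (ltrees N c j)"
proof (rule finite_subset)
  let ?A = "{a. msize a \<le> msize c + N}"
  show "ltrees N c j \<subseteq>
      {t. length (nodes t) \<le> N \<and> (\<forall>v\<in>set (nodes t). nlabel v \<in> ?A \<and> llabel v \<in> ?A)}"
  proof
    fix t assume t: "t \<in> ltrees N c j"
    have "msize (nlabel v) \<le> msize c + N" if "v \<in> set (nodes t)" for v
      using sum_msize_nlabel_ltrees[OF t] that
        member_le_sum_list[of "msize (nlabel v)" "map (\<lambda>v. msize (nlabel v)) (nodes t)"] by force
    moreover have "msize (llabel v) \<le> msize c + N" if "v \<in> set (nodes t)" for v
      using t that nodes_ge_1[of t] by (auto simp: ltrees_iff well_labeled_def)
    ultimately show "t \<in> {t. length (nodes t) \<le> N \<and>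
        (\<forall>v\<in>set (nodes t). nlabel v \<in> ?A \<and> llabel v \<in> ?A)}"
      using t by (simp add: ltrees_iff)
  qed
qed (intro finite_trees finite_msize_le)

definition trees_of_label :: "'n \<Rightarrow> 'n::{finite,linorder} ltree set" where
  "trees_of_label j = {t. effective t \<and> llabel t = axis j 1}"

lemma trees_of_label_fiber_subset:
  "{t. t \<in> trees_of_label j \<and> nmomentum t = c} \<subseteq> (\<Union>N\<in>{1..msize c - 1}. ltrees N c j)"
proof
  fix t assume "t \<in> {t. t \<in> trees_of_label j \<and> nmomentum t = c}"
  then have "t \<in> ltrees (length (nodes t)) c j"
    by (auto simp: trees_of_label_def ltrees_iff momentum_effective) (simp add: effective_def)
  then show "t \<in> (\<Union>N\<in>{1..msize c - 1}. ltrees N c j)"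
    using ltrees_order_bound by blast
qed

lemma finite_fibers_trees: "finite_fibers (trees_of_label j) nmomentum"
  unfolding finite_fibers_def
  by (intro allI finite_subset[OF trees_of_label_fiber_subset] finite_UN_I finite_ltrees) auto

section \<open>Powers of a tree series count canonical forests\<close>

text \<open>The list \<open>js\<close> prescribes the direction of the root line of each tree, in order.\<close>

definition forests :: "'n list \<Rightarrow> 'n::{finite,linorder} ltree list set" where
  "forests js = {ts. map llabel ts = map (\<lambda>j. axis j 1) js \<and> (\<forall>t\<in>set ts. effective t)}"

lemma forests_Nil: "forests [] = {[]}"
  by (auto simp: forests_def)

lemma bij_betw_forests_Cons:
  "bij_betw (\<lambda>(t, ts). t # ts) (trees_of_label j \<times> forests js) (forests (j # js))"
proof (rule bij_betwI')
  fix us assume "us \<in> forests (j # js)"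
  then obtain t ts where "us = t # ts" "(t, ts) \<in> trees_of_label j \<times> forests js"
    by (cases us) (auto simp: forests_def trees_of_label_def)
  then show "\<exists>p\<in>trees_of_label j \<times> forests js. us = (case p of (t, ts) \<Rightarrow> t # ts)"
    by force
qed (auto simp: forests_def trees_of_label_def)

definition tree_series :: "('n::{finite,linorder} ltree \<Rightarrow> complex) \<Rightarrow> 'n::{finite,linorder} vfps" where
  "tree_series v = (\<chi> j. gf (trees_of_label j) nmomentum v)"

text \<open>Multiplying generating functions forms pairs, so a product of tree series enumerates lists of
  trees. Finiteness of the fibers belongs to the induction because the product rule requires it.\<close>

lemma prod_list_tree_series_aux:
  "finite_fibers (forests js) (\<lambda>ts. \<Sum>t\<leftarrow>ts. nmomentum t) \<and>
    (\<Prod>j\<leftarrow>js. tree_series v $ j) = gf (forests js) (\<lambda>ts. \<Sum>t\<leftarrow>ts. nmomentum t) (\<lambda>ts. \<Prod>t\<leftarrow>ts. v t)"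
proof (induction js)
  case Nil
  have "{ts. ts = [] \<and> (\<Sum>t\<leftarrow>ts. nmomentum t) = c} = (if c = 0 then {[]} else {})"
    for c :: "nat ^ 'a::{finite,linorder}"
    by auto
  then show ?case
    by (auto simp: forests_Nil finite_fibers_def mcoeff_gf intro!: mfps_eqI)
next
  case (Cons j js)
  let ?mu = "\<lambda>ts. \<Sum>t\<leftarrow>ts. nmomentum t" and ?v = "\<lambda>ts. \<Prod>t\<leftarrow>ts. v t"
  note bij = bij_betw_forests_Cons[of j js]
  note fin = finite_fibers_trees[of j] Cons.IH[THEN conjunct1]
  have "finite_fibers (forests (j # js)) ?mu"
    by (rule finite_fibers_reindex[OF bij _ finite_fibers_times[OF fin]]) auto
  moreover have "tree_series v $ j * gf (forests js) ?mu ?v = gf (forests (j # js)) ?mu ?v"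
    unfolding tree_series_def vec_lambda_beta gf_times[OF fin]
    by (rule gf_reindex[OF bij]) auto
  ultimately show ?case
    using Cons.IH by simp
qed

lemma finite_fibers_forests: "finite_fibers (forests js) (\<lambda>ts. \<Sum>t\<leftarrow>ts. nmomentum t)"
  using prod_list_tree_series_aux by blast

lemma prod_list_tree_series:
  "(\<Prod>j\<leftarrow>js. tree_series v $ j) =
    gf (forests js) (\<lambda>ts. \<Sum>t\<leftarrow>ts. nmomentum t) (\<lambda>ts. \<Prod>t\<leftarrow>ts. v t)"
  using prod_list_tree_series_aux by blast

definition sorted_dirs :: "nat ^ 'n::{finite,linorder} \<Rightarrow> 'n::{finite,linorder} list" where
  "sorted_dirs b = (THE js. sorted js \<and> (\<Sum>j\<leftarrow>js. axis j 1) = b)"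

lemma sorted_dirs:
  shows sorted_sorted_dirs: "sorted (sorted_dirs b)"
    and sum_sorted_dirs: "(\<Sum>j\<leftarrow>sorted_dirs b. axis j 1) = b"
proof -
  have "\<exists>!js. sorted js \<and> (\<Sum>j\<leftarrow>js. axis j 1) = b"
    using sorted_axis_list_exists[of b] sorted_axis_list_unique by metis
  from theI'[OF this] show "sorted (sorted_dirs b)" "(\<Sum>j\<leftarrow>sorted_dirs b. axis j 1) = b"
    by (simp_all add: sorted_dirs_def)
qed

lemma canonical_iff_sorted:
  assumes "map llabel (subtrees t) = map (\<lambda>j. axis j 1) js"
  shows "canonical t \<longleftrightarrow> sorted js"
proof -
  \<comment> \<open>Express the condition on the trees through their labels alone, where \<open>js\<close> can be inserted.\<close>
  let ?R = "\<lambda>x y. \<forall>i j. x = axis i (1::nat) \<and> y = axis j 1 \<longrightarrow> i \<le> j"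
  have "canonical t \<longleftrightarrow> sorted_wrt ?R (map llabel (subtrees t))"
    by (simp add: canonical_def sorted_wrt_map)
  also have "\<dots> \<longleftrightarrow> sorted js"
    unfolding assms by (simp add: sorted_wrt_map)
  finally show ?thesis .
qed

text \<open>Among the orderings of a list of directions with sum \<open>b\<close> exactly one is sorted. The canonical
  nodes with line sum \<open>b\<close> are therefore those whose entering lines carry precisely this sorted list
  of directions.\<close>

lemma canonical_forest_iff:
  assumes "\<forall>s\<in>set (subtrees t). effective s"
  shows "canonical t \<and> betasum t = b \<longleftrightarrow> subtrees t \<in> forests (sorted_dirs b)"
proof -
  have "\<forall>s\<in>set (subtrees t). \<exists>j. llabel s = axis j 1"
    using assms msize_eq_1_iff effective_iff by metis
  then have "\<exists>js. map llabel (subtrees t) = map (\<lambda>j. axis j 1) js"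
  proof (induction "subtrees t" arbitrary: t)
    case (Cons s ss)
    from Cons(1)[of "LNode 0 0 ss"] Cons(2,3) obtain js j
      where "map llabel ss = map (\<lambda>j. axis j 1) js" "llabel s = axis j 1"
      by (metis list.set_intros(1,2) ltree.sel(3))
    then show ?case
      using Cons(2) by (intro exI[of _ "j # js"]) (simp flip: Cons(2))
  qed simp
  then obtain js where js: "map llabel (subtrees t) = map (\<lambda>j. axis j 1) js"
    by blast
  have "betasum t = (\<Sum>j\<leftarrow>js. axis j 1)"
    by (simp only: betasum_def js)
  then have "canonical t \<and> betasum t = b \<longleftrightarrow> js = sorted_dirs b"
    using canonical_iff_sorted[OF js] sorted_axis_list_unique sorted_dirs[of b] by metis
  also have "\<dots> \<longleftrightarrow> map (\<lambda>j. axis j (1::nat)) js = map (\<lambda>j. axis j 1) (sorted_dirs b)"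
    by (simp add: inj_map_eq_map inj_def)
  also have "\<dots> \<longleftrightarrow> subtrees t \<in> forests (sorted_dirs b)"
    using assms by (simp add: forests_def js)
  finally show ?thesis .
qed

lemma mcoeff_mpow_tree_series:
  "mcoeff (mpow (tree_series v) b) c =
    (\<Sum>ts | ts \<in> forests (sorted_dirs b) \<and> (\<Sum>t\<leftarrow>ts. nmomentum t) = c. \<Prod>t\<leftarrow>ts. v t)"
  using mpow_sum_list_axis[of "tree_series v" "sorted_dirs b"]
  by (simp only: sum_sorted_dirs prod_list_tree_series mcoeff_gf)

section \<open>The root decomposition\<close>

definition tree_val :: "('n::finite ltree \<Rightarrow> complex) \<Rightarrow> 'n::finite ltree \<Rightarrow> complex" where
  "tree_val p t = p t * (\<Prod>v\<leftarrow>nodes t. mbinom (nlabel v) (betasum v) * (\<Prod>w\<leftarrow>subtrees v. p w))"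

lemma tree_val_rec:
  "tree_val p t = p t * mbinom (nlabel t) (betasum t) * (\<Prod>s\<leftarrow>subtrees t. tree_val p s)"
proof -
  have "(\<Prod>s\<leftarrow>ss. p s) * (\<Prod>v\<leftarrow>concat (map nodes ss). w v) =
      (\<Prod>s\<leftarrow>ss. p s * (\<Prod>v\<leftarrow>nodes s. w v))" for ss and w :: "'a ltree \<Rightarrow> complex"
    by (induction ss) (simp_all add: mult_ac)
  then show ?thesis
    unfolding tree_val_def by (subst nodes_eq) (simp add: mult.assoc)
qed

text \<open>The core of the proof. A tree with root line \<open>e\<^sub>j\<close> and momentum \<open>c\<close> is the same thing as a label
  \<open>a\<close> of its root, an exponent \<open>b \<le> a\<close>, and a canonical forest with line sum \<open>b\<close> and momentum
  \<open>c - (a - b)\<close>: these index the terms of \<open>f \<circ> (z + h)\<close>. The divisor \<open>d\<close> is abstract here; it is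
  later \<open>\<lambda>\<^sup>c - \<lambda>\<^sub>j\<close>, which the factor of the root line cancels.\<close>

lemma mcoeff_tree_series_root:
  assumes f: "f \<in> Vsp 1"
    and p: "\<And>t. effective t \<Longrightarrow> llabel t = axis j 1 \<Longrightarrow> nmomentum t = c \<Longrightarrow>
      d * p t = mcoeff (f $ j) (nlabel t)"
  shows "d * mcoeff (tree_series (tree_val p) $ j) c =
    (\<Sum>a | msize a \<le> msize c.
      mcoeff (f $ j) a * mcoeff (mpow (zid + tree_series (tree_val p)) a) c)"
proof -
  \<comment> \<open>\<open>?A\<close>: labels of the root; \<open>?B\<close>: exponents of \<open>h\<close> for which \<open>z\<^sup>a\<^sup>-\<^sup>b\<close> divides \<open>z\<^sup>c\<close>;
      \<open>?T\<close>: forests attached to the root.\<close>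
  let ?A = "{a. msize a \<ge> 2 \<and> msize a \<le> msize c}"
  let ?B = "\<lambda>a. {b. b \<le> a \<and> a - b \<le> c}"
  let ?T = "\<lambda>a b. {ts. ts \<in> forests (sorted_dirs b) \<and> (\<Sum>t\<leftarrow>ts. nmomentum t) = c - (a - b)}"
  let ?w = "\<lambda>a b ts. mcoeff (f $ j) a * mbinom a b * (\<Prod>t\<leftarrow>ts. tree_val p t)"
  let ?tree = "\<lambda>(a, b, ts). LNode a (axis j 1) ts"
  have finA: "finite ?A"
    by (rule finite_subset[OF _ finite_msize_le[of "msize c"]]) auto
  have finB: "finite (?B a)" for a
    by (rule finite_subset[OF _ finite_mindex_le[of a]]) auto
  have finT: "finite (?T a b)" for a b
    using finite_fibers_forests[of "sorted_dirs b"] by (simp add: finite_fibers_def)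
  have "(\<Sum>a | msize a \<le> msize c.
      mcoeff (f $ j) a * mcoeff (mpow (zid + tree_series (tree_val p)) a) c) =
      (\<Sum>a\<in>?A. mcoeff (f $ j) a * mcoeff (mpow (zid + tree_series (tree_val p)) a) c)"
  proof (rule sum.mono_neutral_right[OF finite_msize_le])
    have "mcoeff (f $ j) a = 0" if "\<not> msize a \<ge> 2" for a
      using f that by (simp add: Vsp_iff vanishes_below_def)
    then show "\<forall>a\<in>{a. msize a \<le> msize c} - ?A.
        mcoeff (f $ j) a * mcoeff (mpow (zid + tree_series (tree_val p)) a) c = 0"
      by auto
  qed auto
  also have "\<dots> = (\<Sum>a\<in>?A. \<Sum>b\<in>?B a. \<Sum>ts\<in>?T a b. ?w a b ts)"
  proof (rule sum.cong[OF refl])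
    fix a
    have "mcoeff (mpow (zid + tree_series (tree_val p)) a) c =
        (\<Sum>b\<in>?B a. mbinom a b * mcoeff (mpow (tree_series (tree_val p)) b) (c - (a - b)))"
      unfolding mcoeff_mpow_zid_plus by (rule sum.mono_neutral_cong_right) (auto simp: finite_mindex_le)
    then show "mcoeff (f $ j) a * mcoeff (mpow (zid + tree_series (tree_val p)) a) c =
        (\<Sum>b\<in>?B a. \<Sum>ts\<in>?T a b. ?w a b ts)"
      by (simp add: mcoeff_mpow_tree_series sum_distrib_left mult.assoc)
  qed
  also have "\<dots> = (\<Sum>a\<in>?A. \<Sum>q\<in>Sigma (?B a) (?T a). ?w a (fst q) (snd q))"
    by (rule sum.cong[OF refl], subst sum.Sigma) (auto simp: finB finT case_prod_unfold)
  also have "\<dots> = (\<Sum>q\<in>Sigma ?A (\<lambda>a. Sigma (?B a) (?T a)). ?w (fst q) (fst (snd q)) (snd (snd q)))"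
    by (subst sum.Sigma) (auto simp: finA finB finT case_prod_unfold)
  also have "\<dots> = (\<Sum>t | t \<in> trees_of_label j \<and> nmomentum t = c.
      ?w (nlabel t) (betasum t) (subtrees t))"
  proof (rule sum.reindex_bij_witness
      [where i = "\<lambda>t. (nlabel t, betasum t, subtrees t)"
        and j = ?tree])
    fix q assume q: "q \<in> Sigma ?A (\<lambda>a. Sigma (?B a) (?T a))"
    obtain a b ts where abts: "q = (a, b, ts)" by (cases q) auto
    define t where "t = LNode a (axis j 1) ts"
    have eff: "\<forall>s\<in>set ts. effective s"
      using q by (auto simp: abts forests_def)
    have "canonical t \<and> betasum t = b"
      using canonical_forest_iff[of t b] eff q by (simp add: t_def abts)
    moreover have "effective t"
      using effective_iff[of t] eff q calculation by (simp add: t_def abts)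
    moreover have "nmomentum t = c"
      using nmomentum_rec[of t] q calculation by (simp add: t_def abts mindex_le_add_diff)
    ultimately show "?tree q \<in>
        {t. t \<in> trees_of_label j \<and> nmomentum t = c}"
      and "(\<lambda>t. (nlabel t, betasum t, subtrees t)) (?tree q) = q"
      and "?w (nlabel (?tree q)) (betasum (?tree q)) (subtrees (?tree q)) =
        ?w (fst q) (fst (snd q)) (snd (snd q))"
      by (simp_all add: abts t_def trees_of_label_def)
  next
    fix t assume "t \<in> {t. t \<in> trees_of_label j \<and> nmomentum t = c}"
    then have t: "effective t" "llabel t = axis j 1" "nmomentum t = c"
      by (simp_all add: trees_of_label_def)
    have e: "msize (nlabel t) \<ge> 2" "canonical t" "betasum t \<le> nlabel t"
      "\<forall>s\<in>set (subtrees t). effective s"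
      using t(1) effective_iff by auto
    have "c = nlabel t - betasum t + (\<Sum>s\<leftarrow>subtrees t. nmomentum s)"
      using nmomentum_rec[of t] t(3) by simp
    then have "nlabel t - betasum t \<le> c"
      and "(\<Sum>s\<leftarrow>subtrees t. nmomentum s) = c - (nlabel t - betasum t)"
      by simp_all
    then show "(nlabel t, betasum t, subtrees t) \<in> Sigma ?A (\<lambda>a. Sigma (?B a) (?T a))"
      using e t canonical_forest_iff[of t "betasum t"] msize_nlabel_le_nmomentum[of t] by auto
    show "?tree (nlabel t, betasum t, subtrees t) = t"
      using t(2) by (cases t) simp
  qed
  also have "\<dots> = (\<Sum>t | t \<in> trees_of_label j \<and> nmomentum t = c. d * tree_val p t)"
  proof (rule sum.cong[OF refl])
    fix t assume "t \<in> {t. t \<in> trees_of_label j \<and> nmomentum t = c}"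
    then have "d * p t = mcoeff (f $ j) (nlabel t)"
      using p by (simp add: trees_of_label_def)
    then show "?w (nlabel t) (betasum t) (subtrees t) = d * tree_val p t"
      by (simp add: tree_val_rec[of p t] flip: mult.assoc)
  qed
  finally show ?thesis
    by (simp add: tree_series_def mcoeff_gf sum_distrib_left)
qed

lemma tree_series_in_Vsp: "tree_series v \<in> Vsp 1"
proof -
  have "mcoeff (tree_series v $ j) c = 0" if "msize c < 2" for j c
  proof -
    have "{t. t \<in> trees_of_label j \<and> nmomentum t = c} = {}"
      using trees_of_label_fiber_subset[of j c] that by auto
    then show ?thesis
      by (simp only: tree_series_def mcoeff_gf vec_lambda_beta sum.empty)
  qed
  then show ?thesis
    by (simp add: Vsp_iff vanishes_below_def)
qed

lemma tree_val_not_effective: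
  assumes "well_labeled t" and "\<not> effective t"
  shows "tree_val p t = 0"
proof -
  obtain v where v: "v \<in> set (nodes t)" "\<not> betasum v \<le> nlabel v"
    using assms by (auto simp: effective_def)
  then have "mbinom (nlabel v) (betasum v) = 0"
    by (auto simp: mbinom_def less_eq_vec_def)
  with v(1) have "0 \<in> (\<lambda>v. mbinom (nlabel v) (betasum v) * (\<Prod>w\<leftarrow>subtrees v. p w)) ` set (nodes t)"
    by force
  then show ?thesis
    by (simp add: tree_val_def prod_list_zero_iff)
qed

text \<open>The trees that are dropped in passing to the effective ones have value zero, and every effective
  tree occurs for exactly one order \<open>N\<close> in the range.\<close>

lemma mcoeff_tree_series_ltrees:
  "mcoeff (tree_series (tree_val p) $ j) c =
    (\<Sum>N = 1..msize c - 1. \<Sum>t\<in>ltrees N c j. tree_val p t)"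
proof -
  have "(\<Sum>N = 1..msize c - 1. \<Sum>t\<in>ltrees N c j. tree_val p t) =
      (\<Sum>t\<in>(\<Union>N\<in>{1..msize c - 1}. ltrees N c j). tree_val p t)"
    by (rule sum.UNION_disjoint[symmetric]) (auto simp: finite_ltrees, auto simp: ltrees_iff)
  also have "\<dots> = (\<Sum>t | t \<in> trees_of_label j \<and> nmomentum t = c. tree_val p t)"
  proof (rule sum.mono_neutral_right[OF _ trees_of_label_fiber_subset])
    show "\<forall>t\<in>(\<Union>N\<in>{1..msize c - 1}. ltrees N c j) -
        {t. t \<in> trees_of_label j \<and> nmomentum t = c}. tree_val p t = 0"
      using tree_val_not_effective momentum_effective
      by (fastforce simp: ltrees_iff trees_of_label_def)
  qed (auto simp: finite_ltrees)
  finally show ?thesis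
    by (simp add: tree_series_def mcoeff_gf)
qed

section \<open>The line factors\<close>

lemma matrix_inv_eqI:
  fixes A B :: "'a::comm_ring_1 ^ 'n::finite ^ 'n"
  assumes "A ** B = mat 1" and "B ** A = mat 1"
  shows "matrix_inv A = B"
proof -
  have "A ** matrix_inv A = mat 1 \<and> matrix_inv A ** A = mat 1"
    unfolding matrix_inv_def by (rule someI[of _ B]) (use assms in simp)
  then show ?thesis
    using assms by (metis matrix_mul_assoc matrix_mul_lid matrix_mul_rid)
qed

lemma diag_mult_vec: "(diag d *v x) $ i = d $ i * x $ i"
proof -
  have "(diag d *v x) $ i = (\<Sum>j\<in>UNIV. if i = j then d $ i * x $ j else 0)"
    unfolding matrix_vector_mult_def diag_def vec_lambda_beta by (rule sum.cong) auto
  then show ?thesis by simp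
qed

lemma matrix_inv_diag:
  assumes "\<And>i. d $ i \<noteq> 0"
  shows "matrix_inv (diag d) = diag (\<chi> i. 1 / d $ i)"
  by (rule matrix_inv_eqI)
    (auto simp: matrix_eq vec_eq_iff diag_mult_vec assms simp flip: matrix_vector_mul_assoc)

lemma cdot_axis [simp]: "cdot x (axis j (Suc 0)) = x $ j"
proof -
  have "cdot x (axis j (Suc 0)) = (\<Sum>i\<in>UNIV. if i = j then x $ i else 0)"
    unfolding cdot_def by (rule sum.cong) (auto simp: axis_def)
  then show ?thesis by simp
qed

definition line_factor :: "complex ^ 'n \<Rightarrow> 'n::finite vfps \<Rightarrow> 'n::finite ltree \<Rightarrow> complex" where
  "line_factor lam f t =
    cdot (matrix_inv (Omega lam (momentum t)) *v vcoeff f (nlabel t)) (llabel t)"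

text \<open>On effective trees the momentum is a multi-index of size at least two, so non-resonance makes
  \<open>\<Omega>\<close> invertible.\<close>

lemma line_factor_effective:
  assumes "nonresonant lam" and "effective t" and "llabel t = axis j 1" and "nmomentum t = c"
  shows "(lampow lam (int_vec c) - lam $ j) * line_factor lam f t = mcoeff (f $ j) (nlabel t)"
proof -
  have "2 \<le> msize (nlabel t)"
    using assms(2) effective_iff by blast
  then have "msize c \<ge> 2"
    using msize_nlabel_le_nmomentum[OF assms(2)] assms(4) by simp
  then have nz: "lampow lam (int_vec c) - lam $ i \<noteq> 0" for i
    using assms(1) by (simp add: nonresonant_def)
  then show ?thesis
    using nz[of j] assms(3,4)
    by (simp add: line_factor_def momentum_effective[OF assms(2)] Omega_def matrix_inv_diag
        diag_mult_vec vcoeff_def)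
qed

section \<open>Existence, uniqueness and the tree expansion\<close>

theorem proposition4p2:
  fixes lam :: "complex ^ 'n::{finite,linorder}" and f :: "'n vfps"
  assumes "\<forall>i j. i \<noteq> j \<longrightarrow> lam $ i \<noteq> lam $ j"
    and "invertible (diag lam)"
    and "nonresonant lam"
    and "f \<in> Vsp 1"
  shows "(\<exists>!h. h \<in> Vsp 1 \<and> h = Dinv lam (f \<circ>\<^sub>V (zid + h))) \<and>
    (\<forall>h. h \<in> Vsp 1 \<and> h = Dinv lam (f \<circ>\<^sub>V (zid + h)) \<longrightarrow>
      (\<forall>\<alpha> j. msize \<alpha> \<ge> 2 \<longrightarrow>
        vcoeff h \<alpha> $ j =
          (\<Sum>N = 1..msize \<alpha> - 1. \<Sum>\<theta>\<in>ltrees N \<alpha> j.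
            cdot (matrix_inv (Omega lam (momentum \<theta>)) *v vcoeff f (nlabel \<theta>)) (llabel \<theta>) *
            (\<Prod>v\<leftarrow>nodes \<theta>. mbinom (nlabel v) (betasum v) *
              (\<Prod>w\<leftarrow>subtrees v.
                cdot (matrix_inv (Omega lam (momentum w)) *v vcoeff f (nlabel w)) (llabel w))))))"
proof -
  \<comment> \<open>the solution, given by its tree expansion\<close>
  define H where "H = tree_series (tree_val (line_factor lam f))"
  have H: "H \<in> Vsp 1"
    unfolding H_def by (rule tree_series_in_Vsp)
  have "(lampow lam (int_vec c) - lam $ j) * mcoeff (H $ j) c =
      mcoeff ((f \<circ>\<^sub>V (zid + H)) $ j) c" if "msize c \<ge> 2" for c j
    unfolding mcoeff_vcomp[OF vanishes_below_zid_plus[OF H]] unfolding H_def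
    by (rule mcoeff_tree_series_root[OF assms(4) line_factor_effective[OF assms(3)]])
  then have fixed: "H = Dinv lam (f \<circ>\<^sub>V (zid + H))"
    using fixed_point_iff_coeffs[OF assms(3,4) H] by blast
  have unique: "h = H" if "h \<in> Vsp 1" "h = Dinv lam (f \<circ>\<^sub>V (zid + h))" for h
    by (rule fixed_point_unique[OF assms(3,4) that H fixed])
  have "vcoeff H \<alpha> $ j = (\<Sum>N = 1..msize \<alpha> - 1. \<Sum>\<theta>\<in>ltrees N \<alpha> j.
      tree_val (line_factor lam f) \<theta>)" for \<alpha> j
    by (simp add: vcoeff_def H_def mcoeff_tree_series_ltrees)
  then show ?thesis
    using H fixed unique unfolding tree_val_def line_factor_def by blast
qed

end
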